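(* Let $(H,d)$ be a Hadamard space and $x\in H$. The following properties hold: (1) A sequence $(\phi_{\gamma_n})\subseteq H^*_x$ weak-* converges to $\phi_\gamma\in H^*_x$ if and only if $\phi_{\gamma_n}\to\phi_\gamma$ in the topology $\tau_{w^*}$. (2) $(H^*_x,\tau_{w^*})$ is a Hausdorff space. (3) Every weak-* closed (i.e. $\tau_{w^*}$-closed) set in $H^*_x$ is closed in $(H^*_x,d_* )$.
   Context: A Hadamard space is a complete $\mathrm{CAT}(0)$ space. For $x\in H$, $\Gamma_x(H)$ is the set of all constant speed geodesics $\gamma:[0,1]\to H$ (i.e. $d(\gamma(s),\gamma(t))=|s-t|\,d(\gamma(0),\gamma(1))$ for all $s,t\in[0,1]$) with $\gamma(0)=x$. For a geodesic $\gamma$, $P_\gamma$ denotes the metric projection onto (the image of) $\gamma$. For $\gamma\in\Gamma_x(H)$ define $\phi_\gamma=\phi_\gamma(x;\cdot):H\to\mathbb{R}_+$ by $\phi_\gamma(x;y):=d(x,P_\gamma y)$. Set $H^*_x:=\{\phi_\gamma(x;\cdot):\gamma\in\Gamma_x(H)\}$, with the metric $$d_*(\phi_\gamma,\phi_\eta):=\sup_{y\in H\setminus\{x\}}\frac{|\phi_\gamma(x;y)-\phi_\eta(x;y)|}{d(x,y)}.$$ A sequence $(\phi_{\gamma_n})\subseteq H^*_x$ weak-* converges to $\phi_\gamma\in H^*_x$ if $\lim_{n\to\infty}\phi_{\gamma_n}(x;y)=\phi_\gamma(x;y)$ for all $y\in H$. The weak-* topology $\tau_{w^*}$ on $H^*_x$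 is the topology having as a basis the sets $$U_\gamma(\varepsilon;y_1,\dots,y_n):=\{\phi_\eta\in H^*_x: |\phi_\gamma(x;y_i)-\phi_\eta(x;y_i)|<\varepsilon,\ i=1,\dots,n\},$$ where $\gamma\in\Gamma_x(H)$, $\varepsilon>0$, $n\in\mathbb{N}$, $y_1,\dots,y_n\in H$. *)

theory Defs
  imports "HOL-Analysis.Analysis"
begin

section \<open>CAT(0) and Hadamard spaces\<close>

text \<open>A map on \<open>[0,1]\<close> is represented by a function on the reals; its values outside \<open>[0,1]\<close> are
  never inspected.\<close>

definition geodesic :: "(real \<Rightarrow> 'a::metric_space) \<Rightarrow> bool" where
  "geodesic \<gamma> \<longleftrightarrow>
    (\<forall>s\<in>{0..1}. \<forall>t\<in>{0..1}. dist (\<gamma> s) (\<gamma> t) = \<bar>s - t\<bar> * dist (\<gamma> 0) (\<gamma> 1))"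

text \<open>The points of a side of a geodesic triangle, each paired with its comparison point on the
  Euclidean segment from \<open>a'\<close> to \<open>b'\<close>.\<close>

definition comparison_side ::
    "(real \<Rightarrow> 'a::metric_space) \<Rightarrow> (real^2) \<Rightarrow> (real^2) \<Rightarrow> ('a \<times> (real^2)) set" where
  "comparison_side \<gamma> a' b' = {(\<gamma> t, (1 - t) *\<^sub>R a' + t *\<^sub>R b') | t. t \<in> {0..1}}"

definition geodesic_space :: "'a::metric_space itself \<Rightarrow> bool" where
  "geodesic_space _ \<longleftrightarrow> (\<forall>a b :: 'a. \<exists>\<gamma>. geodesic \<gamma> \<and> \<gamma> 0 = a \<and> \<gamma> 1 = b)"

text \<open>Every geodesic triangle, with sides \<open>\<alpha>\<close> from \<open>a\<close> to \<open>b\<close>, \<open>\<beta>\<close> from \<open>b\<close> to \<open>c\<close> and \<open>\<gamma>\<close> from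
  \<open>c\<close> to \<open>a\<close>, is at least as thin as its comparison triangle \<open>a' b' c'\<close> in the Euclidean plane.\<close>

definition CAT0_space :: "'a::metric_space itself \<Rightarrow> bool" where
  "CAT0_space T \<longleftrightarrow> geodesic_space T \<and>
    (\<forall>(a::'a) b c \<alpha> \<beta> \<gamma> a' b' c'.
       geodesic \<alpha> \<and> \<alpha> 0 = a \<and> \<alpha> 1 = b \<and>
       geodesic \<beta> \<and> \<beta> 0 = b \<and> \<beta> 1 = c \<and>
       geodesic \<gamma> \<and> \<gamma> 0 = c \<and> \<gamma> 1 = a \<and>
       dist a' b' = dist a b \<and> dist b' c' = dist b c \<and> dist c' a' = dist c a \<longrightarrow>
       (let \<Delta> = comparison_side \<alpha> a' b' \<union> comparison_side \<beta> b' c' \<union> comparison_side \<gamma> c' a'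
        in \<forall>(p, p')\<in>\<Delta>. \<forall>(q, q')\<in>\<Delta>. dist p q \<le> dist p' q'))"

definition Hadamard_space :: "'a::metric_space itself \<Rightarrow> bool" where
  "Hadamard_space T \<longleftrightarrow> complete (UNIV :: 'a set) \<and> CAT0_space T"


section \<open>The dual space at a point\<close>

definition geodesics_from :: "'a::metric_space \<Rightarrow> (real \<Rightarrow> 'a) set" where
  "geodesics_from x = {\<gamma>. geodesic \<gamma> \<and> \<gamma> 0 = x}"

definition metric_projection :: "'a::metric_space set \<Rightarrow> 'a \<Rightarrow> 'a" where
  "metric_projection S y = (THE p. p \<in> S \<and> (\<forall>q\<in>S. dist y p \<le> dist y q))"

definition geodesic_functional :: "'a::metric_space \<Rightarrow> (real \<Rightarrow> 'a) \<Rightarrow> 'a \<Rightarrow> real" where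
  "geodesic_functional x \<gamma> y = dist x (metric_projection (path_image \<gamma>) y)"

definition Hstar :: "'a::metric_space \<Rightarrow> ('a \<Rightarrow> real) set" where
  "Hstar x = geodesic_functional x ` geodesics_from x"

text \<open>In a one-point space the supremum would range over the empty set, and off \<open>Hstar x\<close> it may be
  infinite; the value there is set to \<open>0\<close>.\<close>

definition dstar :: "'a::metric_space \<Rightarrow> ('a \<Rightarrow> real) \<Rightarrow> ('a \<Rightarrow> real) \<Rightarrow> real" where
  "dstar x \<phi> \<psi> =
    (if \<phi> \<in> Hstar x \<and> \<psi> \<in> Hstar x \<and> UNIV - {x} \<noteq> {}
     then SUP y\<in>UNIV - {x}. \<bar>\<phi> y - \<psi> y\<bar> / dist x y else 0)"

definition weak_star_convergent_to ::
    "'a::metric_space \<Rightarrow> (nat \<Rightarrow> 'a \<Rightarrow> real) \<Rightarrow> ('a \<Rightarrow> real) \<Rightarrow> bool" where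
  "weak_star_convergent_to x \<Phi> \<phi> \<longleftrightarrow>
    range \<Phi> \<subseteq> Hstar x \<and> \<phi> \<in> Hstar x \<and> (\<forall>y. (\<lambda>n. \<Phi> n y) \<longlonglongrightarrow> \<phi> y)"

definition weak_star_nhd ::
    "'a::metric_space \<Rightarrow> ('a \<Rightarrow> real) \<Rightarrow> real \<Rightarrow> 'a set \<Rightarrow> ('a \<Rightarrow> real) set" where
  "weak_star_nhd x \<phi> \<epsilon> Y = {\<psi> \<in> Hstar x. \<forall>y\<in>Y. \<bar>\<phi> y - \<psi> y\<bar> < \<epsilon>}"

definition weak_star_basis :: "'a::metric_space \<Rightarrow> ('a \<Rightarrow> real) set set" where
  "weak_star_basis x = {weak_star_nhd x \<phi> \<epsilon> Y | \<phi> \<epsilon> Y. \<phi> \<in> Hstar x \<and> 0 < \<epsilon> \<and> finite Y}"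

definition weak_star_topology :: "'a::metric_space \<Rightarrow> ('a \<Rightarrow> real) topology" where
  "weak_star_topology x = topology (arbitrary union_of (\<lambda>U. U \<in> weak_star_basis x))"


section \<open>Well-definedness\<close>

lemma openin_weak_star_topology:
  "openin (weak_star_topology x) = arbitrary union_of (\<lambda>U. U \<in> weak_star_basis x)"
proof -
  have "(arbitrary union_of (\<lambda>U. U \<in> weak_star_basis x)) (S \<inter> T)"
    if ST: "S \<in> weak_star_basis x" "T \<in> weak_star_basis x" for S T
  proof -
    obtain \<phi> \<epsilon> Y where S: "S = weak_star_nhd x \<phi> \<epsilon> Y" "finite Y"
      using ST(1) unfolding weak_star_basis_def by blast
    obtain \<psi> \<delta> Z where T: "T = weak_star_nhd x \<psi> \<delta> Z" "finite Z"
      using ST(2) unfolding weak_star_basis_def by blast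
    have "\<exists>B\<in>weak_star_basis x. \<zeta> \<in> B \<and> B \<subseteq> S \<inter> T" if \<zeta>: "\<zeta> \<in> S \<inter> T" for \<zeta>
    proof -
      define E where "E = insert 1 ((\<lambda>y. \<epsilon> - \<bar>\<phi> y - \<zeta> y\<bar>) ` Y \<union> (\<lambda>y. \<delta> - \<bar>\<psi> y - \<zeta> y\<bar>) ` Z)"
      have fin: "finite E" "E \<noteq> {}" using S T by (auto simp: E_def)
      have pos: "0 < Min E" using \<zeta> S T fin by (auto simp: E_def weak_star_nhd_def)
      have Y: "Min E \<le> \<epsilon> - \<bar>\<phi> y - \<zeta> y\<bar>" if "y \<in> Y" for y
        using fin that by (intro Min_le) (auto simp: E_def)
      have Z: "Min E \<le> \<delta> - \<bar>\<psi> y - \<zeta> y\<bar>" if "y \<in> Z" for y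
        using fin that by (intro Min_le) (auto simp: E_def)
      let ?B = "weak_star_nhd x \<zeta> (Min E) (Y \<union> Z)"
      have "?B \<in> weak_star_basis x"
        using \<zeta> S T pos by (auto simp: weak_star_basis_def weak_star_nhd_def)
      moreover have "\<zeta> \<in> ?B" using \<zeta> S pos by (auto simp: weak_star_nhd_def)
      moreover have "?B \<subseteq> S \<inter> T"
      proof
        fix \<eta> assume \<eta>: "\<eta> \<in> ?B"
        have "\<bar>\<phi> y - \<eta> y\<bar> < \<epsilon>" if "y \<in> Y" for y
        proof -
          have "\<bar>\<zeta> y - \<eta> y\<bar> < Min E" using \<eta> that by (auto simp: weak_star_nhd_def)
          with Y[OF that] show ?thesis by linarith
        qed
        moreover have "\<bar>\<psi> y - \<eta> y\<bar> < \<delta>" if "y \<in> Z" for y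
        proof -
          have "\<bar>\<zeta> y - \<eta> y\<bar> < Min E" using \<eta> that by (auto simp: weak_star_nhd_def)
          with Z[OF that] show ?thesis by linarith
        qed
        ultimately show "\<eta> \<in> S \<inter> T" using \<eta> S T by (auto simp: weak_star_nhd_def)
      qed
      ultimately show ?thesis by blast
    qed
    then show ?thesis unfolding arbitrary_union_of_alt by blast
  qed
  then show ?thesis
    unfolding weak_star_topology_def
    by (intro topology_inverse') (simp add: istopology_base_eq)
qed

lemma topspace_weak_star_topology: "topspace (weak_star_topology x) = Hstar x"
proof -
  have "S \<subseteq> Hstar x" if "openin (weak_star_topology x) S" for S
    using that by (fastforce simp: openin_weak_star_topology arbitrary_union_of_alt
        weak_star_basis_def weak_star_nhd_def)
  moreover have "openin (weak_star_topology x) (Hstar x)"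
    unfolding openin_weak_star_topology arbitrary_union_of_alt
  proof
    fix \<phi> assume "\<phi> \<in> Hstar x"
    moreover have "weak_star_nhd x \<phi> 1 {} = Hstar x" by (auto simp: weak_star_nhd_def)
    ultimately have "Hstar x \<in> weak_star_basis x"
      unfolding weak_star_basis_def by (intro CollectI exI[of _ \<phi>] exI[of _ 1] exI[of _ "{}"]) auto
    with \<open>\<phi> \<in> Hstar x\<close> show "\<exists>U. U \<in> weak_star_basis x \<and> \<phi> \<in> U \<and> U \<subseteq> Hstar x" by blast
  qed
  ultimately show ?thesis by (auto simp: topspace_def)
qed

lemma geodesic_continuous:
  assumes "geodesic \<gamma>"
  shows "continuous_on {0..1} \<gamma>"
proof -
  have "(dist (\<gamma> 0) (\<gamma> 1))-lipschitz_on {0..1} \<gamma>"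
    unfolding lipschitz_on_def
  proof (intro conjI ballI)
    fix s t :: real assume "s \<in> {0..1}" "t \<in> {0..1}"
    then have "dist (\<gamma> s) (\<gamma> t) = \<bar>s - t\<bar> * dist (\<gamma> 0) (\<gamma> 1)"
      using assms unfolding geodesic_def by blast
    then show "dist (\<gamma> s) (\<gamma> t) \<le> dist (\<gamma> 0) (\<gamma> 1) * dist s t"
      by (simp only: dist_real_def mult.commute)
  qed simp
  then show ?thesis by (rule lipschitz_on_continuous_on)
qed

lemma metric_projection_ex1:
  fixes \<gamma> :: "real \<Rightarrow> 'a::metric_space"
  assumes H: "CAT0_space TYPE('a)" and \<gamma>: "geodesic \<gamma>"
  shows "\<exists>!p. p \<in> path_image \<gamma> \<and> (\<forall>q\<in>path_image \<gamma>. dist y p \<le> dist y q)"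
proof (rule ex_ex1I)
  have "compact (path_image \<gamma>)"
    unfolding path_image_def by (intro compact_continuous_image geodesic_continuous \<gamma> compact_Icc)
  moreover have "path_image \<gamma> \<noteq> {}" by (simp add: path_image_def)
  ultimately show "\<exists>p. p \<in> path_image \<gamma> \<and> (\<forall>q\<in>path_image \<gamma>. dist y p \<le> dist y q)"
    using continuous_attains_inf[of "path_image \<gamma>" "dist y"]
      continuous_on_dist[OF continuous_on_const continuous_on_id] by blast
next
  fix u v
  assume u: "u \<in> path_image \<gamma> \<and> (\<forall>q\<in>path_image \<gamma>. dist y u \<le> dist y q)"
    and v: "v \<in> path_image \<gamma> \<and> (\<forall>q\<in>path_image \<gamma>. dist y v \<le> dist y q)"
  obtain s where s: "s \<in> {0..1}" "u = \<gamma> s" using u by (auto simp: path_image_def)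
  obtain t where t: "t \<in> {0..1}" "v = \<gamma> t" using v by (auto simp: path_image_def)
  define r where "r = dist y u"
  define d where "d = dist u v"
  have r: "dist y v = r" using u v by (auto simp: r_def intro: antisym)
  have "d \<le> 2 * r" using dist_triangle3[of u v y] r by (simp add: d_def r_def)
  then have dr: "d\<^sup>2 / 4 \<le> r\<^sup>2"
    using power_mono[of d "2 * r" 2] by (simp add: d_def power_mult_distrib)
  define \<delta> where "\<delta> = (\<lambda>\<theta>. \<gamma> ((1 - \<theta>) * s + \<theta> * t))"
  have in01: "(1 - \<theta>) * s + \<theta> * t \<in> {0..1}" if "\<theta> \<in> {0..1}" for \<theta>
    using convexD[of "{0..1::real}" s t "1 - \<theta>" \<theta>] s(1) t(1) that by simp
  have \<delta>: "geodesic \<delta>" "\<delta> 0 = u" "\<delta> 1 = v"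
  proof -
    show "geodesic \<delta>" unfolding geodesic_def
    proof (intro ballI)
      fix \<theta> \<theta>' :: real assume \<theta>: "\<theta> \<in> {0..1}" "\<theta>' \<in> {0..1}"
      have *: "dist (\<gamma> p) (\<gamma> q) = \<bar>p - q\<bar> * dist (\<gamma> 0) (\<gamma> 1)" if "p \<in> {0..1}" "q \<in> {0..1}" for p q
        using \<gamma> that unfolding geodesic_def by blast
      have "((1 - \<theta>) * s + \<theta> * t) - ((1 - \<theta>') * s + \<theta>' * t) = (\<theta> - \<theta>') * (t - s)"
        by (simp add: algebra_simps)
      then have "dist (\<delta> \<theta>) (\<delta> \<theta>') = \<bar>\<theta> - \<theta>'\<bar> * (\<bar>s - t\<bar> * dist (\<gamma> 0) (\<gamma> 1))"
        unfolding \<delta>_def *[OF in01[OF \<theta>(1)] in01[OF \<theta>(2)]]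
        by (simp add: abs_mult abs_minus_commute)
      then show "dist (\<delta> \<theta>) (\<delta> \<theta>') = \<bar>\<theta> - \<theta>'\<bar> * dist (\<delta> 0) (\<delta> 1)"
        using *[OF s(1) t(1)] by (simp add: \<delta>_def)
    qed
  qed (auto simp: \<delta>_def s t)
  have "geodesic_space TYPE('a)" using H by (simp add: CAT0_space_def)
  then obtain \<rho> \<sigma> where \<rho>: "geodesic \<rho>" "\<rho> 0 = v" "\<rho> 1 = y" and \<sigma>: "geodesic \<sigma>" "\<sigma> 0 = y" "\<sigma> 1 = u"
    unfolding geodesic_space_def by metis
  define u' where "u' = (0 :: real^2)"
  define v' where "v' = (vector [d, 0] :: real^2)"
  define y' where "y' = (vector [d / 2, sqrt (r\<^sup>2 - d\<^sup>2 / 4)] :: real^2)"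
  have nn: "0 \<le> d" "0 \<le> r" by (auto simp: d_def r_def)
  have comp: "dist u' v' = d" "dist v' y' = r" "dist y' u' = r"
    using dr nn
    by (simp_all add: u'_def v'_def y'_def dist_vec_def L2_set_def sum_2 dist_real_def
        power_divide)
  let ?\<Delta> = "comparison_side \<delta> u' v' \<union> comparison_side \<rho> v' y' \<union> comparison_side \<sigma> y' u'"
  have thin: "\<forall>(p, p')\<in>?\<Delta>. \<forall>(q, q')\<in>?\<Delta>. dist p q \<le> dist p' q'"
  proof -
    have "geodesic \<delta> \<and> \<delta> 0 = u \<and> \<delta> 1 = v \<and> geodesic \<rho> \<and> \<rho> 0 = v \<and> \<rho> 1 = y \<and>
      geodesic \<sigma> \<and> \<sigma> 0 = y \<and> \<sigma> 1 = u \<and>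
      dist u' v' = dist u v \<and> dist v' y' = dist v y \<and> dist y' u' = dist y u"
      using \<delta> \<rho> \<sigma> comp r by (simp add: d_def r_def dist_commute)
    with H show ?thesis unfolding CAT0_space_def Let_def by blast
  qed
  define m where "m = (1/2) *\<^sub>R u' + (1/2) *\<^sub>R v'"
  have "(\<delta> (1/2), m) \<in> ?\<Delta>"
    unfolding comparison_side_def m_def by (intro UnI1 CollectI exI[of _ "1/2"]) auto
  moreover have "(y, y') \<in> ?\<Delta>"
    unfolding comparison_side_def using \<sigma> by (intro UnI2 CollectI exI[of _ 0]) auto
  ultimately have "dist y (\<delta> (1/2)) \<le> dist y' m" using thin by blast
  also have "dist y' m = sqrt (r\<^sup>2 - d\<^sup>2 / 4)"
    using dr by (simp add: m_def u'_def v'_def y'_def dist_vec_def L2_set_def sum_2 dist_real_def)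
  finally have le: "dist y (\<delta> (1/2)) \<le> sqrt (r\<^sup>2 - d\<^sup>2 / 4)" .
  have "\<delta> (1/2) \<in> path_image \<gamma>"
    using in01[of "1/2"] unfolding \<delta>_def path_image_def by (intro imageI) auto
  then have "r \<le> dist y (\<delta> (1/2))" using u by (simp add: r_def)
  with le have "r \<le> sqrt (r\<^sup>2 - d\<^sup>2 / 4)" by linarith
  then have "r\<^sup>2 \<le> r\<^sup>2 - d\<^sup>2 / 4" using nn dr by (metis power_mono real_sqrt_pow2 diff_ge_0_iff_ge)
  then have "d = 0" by simp
  then show "u = v" by (simp add: d_def)
qed

lemma metric_projection:
  fixes \<gamma> :: "real \<Rightarrow> 'a::metric_space"
  assumes "CAT0_space TYPE('a)" "geodesic \<gamma>"
  shows "metric_projection (path_image \<gamma>) y \<in> path_image \<gamma>"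
    and "q \<in> path_image \<gamma> \<Longrightarrow> dist y (metric_projection (path_image \<gamma>) y) \<le> dist y q"
  using theI'[OF metric_projection_ex1[OF assms, of y]] by (auto simp: metric_projection_def)

lemma Hstar_bounds:
  fixes x :: "'a::metric_space"
  assumes "CAT0_space TYPE('a)" "\<phi> \<in> Hstar x"
  shows "0 \<le> \<phi> y" "\<phi> y \<le> 2 * dist x y"
proof -
  obtain \<gamma> where \<gamma>: "geodesic \<gamma>" "\<gamma> 0 = x" "\<phi> = geodesic_functional x \<gamma>"
    using assms(2) by (auto simp: Hstar_def geodesics_from_def)
  then have "x \<in> path_image \<gamma>" by (force simp: path_image_def)
  then have "dist y (metric_projection (path_image \<gamma>) y) \<le> dist y x"
    by (rule metric_projection(2)[OF assms(1) \<gamma>(1)])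
  then show "0 \<le> \<phi> y" "\<phi> y \<le> 2 * dist x y"
    using dist_triangle[of x "metric_projection (path_image \<gamma>) y" y]
    by (auto simp: \<gamma>(3) geodesic_functional_def dist_commute)
qed

lemma dstar_bdd:
  fixes x :: "'a::metric_space"
  assumes "CAT0_space TYPE('a)" "\<phi> \<in> Hstar x" "\<psi> \<in> Hstar x"
  shows "bdd_above ((\<lambda>y. \<bar>\<phi> y - \<psi> y\<bar> / dist x y) ` (UNIV - {x}))"
proof (intro bdd_aboveI2[of _ _ 2])
  fix y assume "y \<in> UNIV - {x}"
  then show "\<bar>\<phi> y - \<psi> y\<bar> / dist x y \<le> 2"
    using Hstar_bounds[OF assms(1,2), of y] Hstar_bounds[OF assms(1,3), of y]
    by (simp add: divide_le_eq abs_le_iff)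
qed

lemma Metric_space_dstar:
  fixes x :: "'a::metric_space"
  assumes H: "CAT0_space TYPE('a)"
  shows "Metric_space (Hstar x) (dstar x)"
proof
  have up: "\<bar>\<phi> y - \<psi> y\<bar> / dist x y \<le> dstar x \<phi> \<psi>"
    if "\<phi> \<in> Hstar x" "\<psi> \<in> Hstar x" "y \<noteq> x" for \<phi> \<psi> y
  proof -
    have "\<bar>\<phi> y - \<psi> y\<bar> / dist x y \<le> (SUP y\<in>UNIV - {x}. \<bar>\<phi> y - \<psi> y\<bar> / dist x y)"
      using that by (intro cSUP_upper dstar_bdd H) auto
    then show ?thesis using that by (auto simp: dstar_def)
  qed
  show nn: "0 \<le> dstar x \<phi> \<psi>" for \<phi> \<psi>
  proof (cases "\<phi> \<in> Hstar x \<and> \<psi> \<in> Hstar x \<and> UNIV - {x} \<noteq> {}")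
    case True
    then obtain y where "y \<noteq> x" by blast
    have "0 \<le> \<bar>\<phi> y - \<psi> y\<bar> / dist x y" by simp
    also have "\<dots> \<le> dstar x \<phi> \<psi>" using up True \<open>y \<noteq> x\<close> by blast
    finally show ?thesis .
  qed (auto simp: dstar_def)
  show "dstar x \<phi> \<psi> = dstar x \<psi> \<phi>" for \<phi> \<psi>
    by (simp add: dstar_def abs_minus_commute conj_commute)
  show "dstar x \<phi> \<psi> = 0 \<longleftrightarrow> \<phi> = \<psi>" if in_H: "\<phi> \<in> Hstar x" "\<psi> \<in> Hstar x" for \<phi> \<psi>
  proof
    assume z: "dstar x \<phi> \<psi> = 0"
    show "\<phi> = \<psi>"
    proof
      fix y
      show "\<phi> y = \<psi> y"
      proof (cases "y = x")
        case True
        then show ?thesis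
          using Hstar_bounds[OF H in_H(1), of x] Hstar_bounds[OF H in_H(2), of x] by simp
      next
        case False
        then have "dist x y > 0" by simp
        then show ?thesis using up[OF in_H False] z by (simp add: divide_le_0_iff)
      qed
    qed
  qed (auto simp: dstar_def)
  show "dstar x \<phi> \<zeta> \<le> dstar x \<phi> \<psi> + dstar x \<psi> \<zeta>"
    if in_H: "\<phi> \<in> Hstar x" "\<psi> \<in> Hstar x" "\<zeta> \<in> Hstar x" for \<phi> \<psi> \<zeta>
  proof (cases "UNIV - {x} = {}")
    case True
    then show ?thesis by (simp add: dstar_def)
  next
    case False
    have "(SUP y\<in>UNIV - {x}. \<bar>\<phi> y - \<zeta> y\<bar> / dist x y) \<le> dstar x \<phi> \<psi> + dstar x \<psi> \<zeta>"
    proof (intro cSUP_least False)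
      fix y assume "y \<in> UNIV - {x}"
      then have y: "y \<noteq> x" by simp
      have "\<bar>\<phi> y - \<zeta> y\<bar> / dist x y \<le> (\<bar>\<phi> y - \<psi> y\<bar> + \<bar>\<psi> y - \<zeta> y\<bar>) / dist x y"
        by (intro divide_right_mono) auto
      also have "\<dots> \<le> dstar x \<phi> \<psi> + dstar x \<psi> \<zeta>"
        using up[OF in_H(1,2) y] up[OF in_H(2,3) y] by (simp add: add_divide_distrib)
      finally show "\<bar>\<phi> y - \<zeta> y\<bar> / dist x y \<le> dstar x \<phi> \<psi> + dstar x \<psi> \<zeta>" .
    qed
    then show ?thesis using in_H False by (simp add: dstar_def)
  qed
qed

end

theory Submission
  imports Defs
begin

text \<open>The weak-* topology is nothing but the topology of pointwise convergence: \<open>H\<^sup>*\<^sub>x\<close> is a set of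
  real functions on \<open>H\<close>, and \<open>\<tau>\<^sub>w\<^sub>*\<close> is the topology that it inherits from the product of copies of
  the real line indexed by \<open>H\<close> (\<open>weak_star_topology_eq_pointwise\<close>). In a subspace of a product,
  sequential convergence is coordinatewise convergence, which is (1), and the Hausdorff property
  is inherited from the real line, which is (2). A map into such a subspace is continuous as soon
  as its coordinates, the evaluations \<open>\<phi> \<mapsto> \<phi>(x; y)\<close>, are; since
  \<open>|\<phi>(x; y) - \<psi>(x; y)| \<le> d\<^sub>*(\<phi>, \<psi>) d(x, y)\<close>, the evaluations are Lipschitz for \<open>d\<^sub>*\<close>
  (\<open>evaluation_le_dstar\<close>), so the identity from the metric topology to the weak-* topology is
  continuous, which is (3). The geometry of \<open>H\<close> enters through the bounds
  \<open>0 \<le> \<phi>(x; y) \<le> 2 d(x, y)\<close>, which make the supremum in \<open>d\<^sub>*\<close> finite and every functional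
  vanish at \<open>x\<close>.\<close>

text \<open>The product topology is the initial topology of the coordinate maps, so continuity into a set
  of functions can be checked pointwise.\<close>

lemma continuous_map_id_pointwise:
  fixes F :: "('a \<Rightarrow> 'b::topological_space) set"
  assumes top: "topspace X = F"
    and eval: "\<And>y. continuous_map X euclidean (\<lambda>f. f y)"
  shows "continuous_map X (top_of_set F) (\<lambda>f. f)"
proof -
  have "continuous_map X (product_topology (\<lambda>_. euclidean) UNIV) (\<lambda>f. f)"
    using eval by (simp add: continuous_map_componentwise_UNIV)
  then show ?thesis
    by (simp add: euclidean_product_topology continuous_map_in_subtopology top)
qed

text \<open>The preimage of a ball of radius \<open>\<epsilon>\<close> around \<open>\<phi> y\<close> is itself a basic neighbourhood of \<open>\<phi>\<close>,
  with \<open>y\<close> as its single test point.\<close>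

lemma continuous_map_weak_star_evaluation:
  "continuous_map (weak_star_topology x) euclidean (\<lambda>\<phi>. \<phi> y)"
  unfolding continuous_map_def topspace_weak_star_topology
proof (intro conjI allI impI)
  fix U :: "real set"
  assume "openin euclidean U"
  then have U: "open U" by simp
  show "openin (weak_star_topology x) {\<phi> \<in> Hstar x. \<phi> y \<in> U}"
    unfolding openin_weak_star_topology arbitrary_union_of_alt
  proof
    fix \<phi> assume \<phi>: "\<phi> \<in> {\<phi> \<in> Hstar x. \<phi> y \<in> U}"
    then obtain \<epsilon> where \<epsilon>: "0 < \<epsilon>" "ball (\<phi> y) \<epsilon> \<subseteq> U"
      using U by (auto simp: open_contains_ball)
    let ?N = "weak_star_nhd x \<phi> \<epsilon> {y}"
    have "?N \<in> weak_star_basis x"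
      using \<phi> \<epsilon>(1) unfolding weak_star_basis_def by blast
    moreover have "\<phi> \<in> ?N" "?N \<subseteq> {\<phi> \<in> Hstar x. \<phi> y \<in> U}"
      using \<phi> \<epsilon> by (auto simp: weak_star_nhd_def dist_real_def subset_iff)
    ultimately show "\<exists>N. N \<in> weak_star_basis x \<and> \<phi> \<in> N \<and> N \<subseteq> {\<phi> \<in> Hstar x. \<phi> y \<in> U}"
      by blast
  qed
qed auto

lemma openin_pointwise_weak_star_nhd:
  assumes "finite Y"
  shows "openin (top_of_set (Hstar x)) (weak_star_nhd x \<phi> \<epsilon> Y)"
proof -
  have "open {\<psi>. \<bar>\<phi> y - \<psi> y\<bar> < \<epsilon>}" for y
    by (intro open_Collect_less continuous_intros continuous_on_product_coordinates)
  then have "open (\<Inter>y\<in>Y. {\<psi>. \<bar>\<phi> y - \<psi> y\<bar> < \<epsilon>})"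
    using assms by (intro open_INT) auto
  moreover have "weak_star_nhd x \<phi> \<epsilon> Y = Hstar x \<inter> (\<Inter>y\<in>Y. {\<psi>. \<bar>\<phi> y - \<psi> y\<bar> < \<epsilon>})"
    by (auto simp: weak_star_nhd_def)
  ultimately show ?thesis by (auto simp: openin_open)
qed

text \<open>Basic weak-* neighbourhoods are cut out by finitely many open conditions on coordinates, so
  they are open for pointwise convergence; conversely, the evaluations are weak-* continuous, so
  the weak-* topology is at least as fine as the topology that they generate.\<close>

theorem weak_star_topology_eq_pointwise:
  "weak_star_topology x = top_of_set (Hstar x)"
proof -
  have "openin (weak_star_topology x) S \<longleftrightarrow> openin (top_of_set (Hstar x)) S" for S
  proof
    assume "openin (weak_star_topology x) S"
    then obtain \<B> where "\<B> \<subseteq> weak_star_basis x" "S = \<Union>\<B>"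
      by (auto simp: openin_weak_star_topology union_of_def)
    moreover have "openin (top_of_set (Hstar x)) B" if "B \<in> weak_star_basis x" for B
      using that openin_pointwise_weak_star_nhd by (auto simp: weak_star_basis_def)
    ultimately show "openin (top_of_set (Hstar x)) S" by blast
  next
    assume S: "openin (top_of_set (Hstar x)) S"
    have "continuous_map (weak_star_topology x) (top_of_set (Hstar x)) (\<lambda>\<phi>. \<phi>)"
      by (intro continuous_map_id_pointwise topspace_weak_star_topology
          continuous_map_weak_star_evaluation)
    from openin_continuous_map_preimage[OF this S]
    have "openin (weak_star_topology x) {\<phi> \<in> Hstar x. \<phi> \<in> S}"
      by (simp add: topspace_weak_star_topology)
    moreover have "{\<phi> \<in> Hstar x. \<phi> \<in> S} = S"
      using openin_subset[OF S] by auto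
    ultimately show "openin (weak_star_topology x) S" by simp
  qed
  then show ?thesis by (simp add: topology_eq)
qed

lemma tendsto_fun_iff_pointwise:
  fixes f :: "'c \<Rightarrow> 'a \<Rightarrow> 'b::topological_space"
  shows "(f \<longlongrightarrow> l) F \<longleftrightarrow> (\<forall>y. ((\<lambda>n. f n y) \<longlongrightarrow> l y) F)"
  using limitin_componentwise[of "\<lambda>_::'a. euclidean :: 'b topology" UNIV f l F]
  by (simp add: euclidean_product_topology)

text \<open>At \<open>y = x\<close>, a point over which the supremum does not range, both functionals vanish.\<close>

lemma evaluation_le_dstar:
  fixes x :: "'a::metric_space"
  assumes H: "CAT0_space TYPE('a)" and \<phi>: "\<phi> \<in> Hstar x" and \<psi>: "\<psi> \<in> Hstar x"
  shows "\<bar>\<phi> y - \<psi> y\<bar> \<le> dstar x \<phi> \<psi> * dist x y"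
proof (cases "y = x")
  case True
  then show ?thesis
    using Hstar_bounds[OF H \<phi>, of x] Hstar_bounds[OF H \<psi>, of x] by simp
next
  case False
  then have y: "y \<in> UNIV - {x}" by simp
  have "\<bar>\<phi> y - \<psi> y\<bar> / dist x y \<le> (SUP y\<in>UNIV - {x}. \<bar>\<phi> y - \<psi> y\<bar> / dist x y)"
    by (intro cSUP_upper dstar_bdd H \<phi> \<psi> y)
  also have "\<dots> = dstar x \<phi> \<psi>"
    using \<phi> \<psi> y by (auto simp: dstar_def)
  finally show ?thesis
    using False by (simp add: divide_le_eq)
qed

lemma continuous_map_dstar_evaluation:
  fixes x :: "'a::metric_space"
  assumes H: "CAT0_space TYPE('a)"
  shows "continuous_map (Metric_space.mtopology (Hstar x) (dstar x)) euclidean (\<lambda>\<phi>. \<phi> y)"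
proof -
  interpret Metric_space "Hstar x" "dstar x"
    by (rule Metric_space_dstar[OF H])
  have "Lipschitz_continuous_map (metric (Hstar x, dstar x)) euclidean_metric (\<lambda>\<phi>. \<phi> y)"
    unfolding Lipschitz_continuous_map_def
    using evaluation_le_dstar[OF H]
    by (auto simp: dist_real_def mult.commute intro!: exI[of _ "dist x y"])
  from Lipschitz_continuous_imp_continuous_map[OF this] show ?thesis by simp
qed

theorem theorem9:
  fixes x :: "'a::metric_space"
  assumes "Hadamard_space TYPE('a)"
  shows "(\<forall>\<Phi> \<phi>. range \<Phi> \<subseteq> Hstar x \<and> \<phi> \<in> Hstar x \<longrightarrow>
            (weak_star_convergent_to x \<Phi> \<phi> \<longleftrightarrow>
             limitin (weak_star_topology x) \<Phi> \<phi> sequentially)) \<and>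
         Hausdorff_space (weak_star_topology x) \<and>
         (\<forall>C. closedin (weak_star_topology x) C \<longrightarrow>
            closedin (Metric_space.mtopology (Hstar x) (dstar x)) C)"
proof (intro conjI allI impI)
  fix \<Phi> :: "nat \<Rightarrow> 'a \<Rightarrow> real" and \<phi>
  assume "range \<Phi> \<subseteq> Hstar x \<and> \<phi> \<in> Hstar x"
  then show "weak_star_convergent_to x \<Phi> \<phi> \<longleftrightarrow>
      limitin (weak_star_topology x) \<Phi> \<phi> sequentially"
    by (auto simp: weak_star_convergent_to_def weak_star_topology_eq_pointwise
        limitin_subtopology tendsto_fun_iff_pointwise image_subset_iff)
next
  have "Hausdorff_space (euclidean :: ('a \<Rightarrow> real) topology)"
    by (simp add: euclidean_product_topology[symmetric] Hausdorff_space_product_topology)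
  then show "Hausdorff_space (weak_star_topology x)"
    by (simp add: weak_star_topology_eq_pointwise Hausdorff_space_subtopology)
next
  fix C assume C: "closedin (weak_star_topology x) C"
  have H: "CAT0_space TYPE('a)"
    using assms by (simp add: Hadamard_space_def)
  interpret Metric_space "Hstar x" "dstar x"
    by (rule Metric_space_dstar[OF H])
  have "continuous_map mtopology (weak_star_topology x) (\<lambda>\<phi>. \<phi>)"
    unfolding weak_star_topology_eq_pointwise
    by (intro continuous_map_id_pointwise continuous_map_dstar_evaluation H) simp
  from closedin_continuous_map_preimage[OF this C]
  have "closedin mtopology {\<phi> \<in> Hstar x. \<phi> \<in> C}" by simp
  moreover have "{\<phi> \<in> Hstar x. \<phi> \<in> C} = C"
    using closedin_subset[OF C] by (auto simp: topspace_weak_star_topology)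
  ultimately show "closedin mtopology C" by simp
qed

end
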